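(* Let $T$ be a $3$-simplex with barycentric coordinates $\lambda_0,\lambda_1,\lambda_2,\lambda_3$ and let $$\psi_{w}=d\lambda_0-d\lambda_1+d\lambda_2-d\lambda_3,\quad \psi_{p}=d\lambda_0+d\lambda_1-d\lambda_2-d\lambda_3,\quad \psi_{k}=d\lambda_0-d\lambda_1-d\lambda_2+d\lambda_3.$$ An $\mathbb{R}$-invariant basis of the space $\mathbb{R}\mathcal{P}_0\Lambda^{2}(T)$ of constant real differential $2$-forms over $T$ is given by $$\psi_{w}\wedge\psi_{p},\quad \psi_{w}\wedge\psi_{k},\quad \psi_{p}\wedge\psi_{k}.$$ In particular, this is also a $\mathbb{C}$-invariant basis of the space $\mathbb{C}\mathcal{P}_{0}\Lambda^{2}(T)$ of constant complex $2$-forms over $T$.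
   Context: $T$ is the convex hull of affinely independent points $v_0,\dots,v_n$ in a Euclidean space (here $n=3$); $\lambda_i$ are its barycentric coordinates (affine functions on $T$ with $\lambda_i(v_j)=\delta_{ij}$), $d\lambda_i$ their exterior derivatives. For $\mathbb{F}\in\{\mathbb{R},\mathbb{C}\}$, $\mathbb{F}\mathcal{P}_0\Lambda^k(T)$ is the $\mathbb{F}$-span of the forms $d\lambda_{i_1}\wedge\dots\wedge d\lambda_{i_k}$, i.e. the constant $k$-forms on $T$ with coefficients in $\mathbb{F}$. $\mathrm{Perm}(n)$ is the group of permutations of $\{0,\dots,n\}$; for $\pi\in\mathrm{Perm}(n)$, $S_\pi:T\to T$ is the affine automorphism with $S_\pi(v_i)=v_{\pi^{-1}(i)}$, with pullback $S_\pi^*$ on forms. A finite set $\{\omega_1,\dots,\omega_M\}$ of pairwise distinct forms on $T$ is $\mathbb{F}$-invariant if for every $\pi\in\mathrm{Perm}(n)$ there are a permutation $\tau$ of $\{1,\dots,M\}$ and $\chi_1,\dots,\chi_M\in\mathbb{F}$ with $|\chi_i|=1$ and $S_\pi^*\omega_i=\chi_i\omega_{\tau(i)}$ for all $i$. *)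

theory Defs
  imports "HOL-Analysis.Analysis" "HOL-Library.Function_Algebras"
begin

section \<open>Differential forms on a convex set\<close>

text \<open>
  The set \<open>T\<close> may have lower dimension than the ambient space. Its tangent space (the same at
  every point, as \<open>T\<close> is convex) is the linear space parallel to its affine hull.
\<close>

definition tangent_space :: "'a::real_vector set \<Rightarrow> 'a set" where
  "tangent_space T = span {x - y | x y. x \<in> T \<and> y \<in> T}"

text \<open>
  A \<open>k\<close>-form \<open>\<omega>\<close> on \<open>T\<close> with values in \<open>'f\<close> is a function of a point \<open>x \<in> T\<close> and a list of
  \<open>k\<close> tangent vectors. So that equality of functions is equality of forms on \<open>T\<close>, all forms
  below are set to \<open>0\<close> on all other arguments by \<open>form_on\<close>.
\<close>

type_synonym ('a, 'f) form = "'a \<Rightarrow> 'a list \<Rightarrow> 'f"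

definition form_on :: "'a::real_vector set \<Rightarrow> nat \<Rightarrow> ('a, 'f::zero) form \<Rightarrow> ('a, 'f) form" where
  "form_on T k \<omega> =
     (\<lambda>x us. if x \<in> T \<and> length us = k \<and> set us \<subseteq> tangent_space T then \<omega> x us else 0)"

text \<open>
  Addition and subtraction of forms are pointwise, by \<^theory>\<open>HOL-Library.Function_Algebras\<close>.
\<close>

definition scale_form :: "'f \<Rightarrow> ('a, 'f::field) form \<Rightarrow> ('a, 'f) form" where
  "scale_form c \<omega> = (\<lambda>x us. c * \<omega> x us)"

global_interpretation forms: vector_space "scale_form :: 'f::field \<Rightarrow> ('a, 'f) form \<Rightarrow> ('a, 'f) form"
  by unfold_locales (auto simp: scale_form_def fun_eq_iff algebra_simps)

text \<open>
  The derivative within \<open>T\<close> is unique on the tangent space of \<open>T\<close> only, and \<open>form_on\<close>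
  discards its values on other vectors.
\<close>

definition ext_deriv ::
  "'a::real_normed_vector set \<Rightarrow> ('a \<Rightarrow> 'f::real_normed_field) \<Rightarrow> ('a, 'f) form" where
  "ext_deriv T f = form_on T 1 (\<lambda>x us. frechet_derivative f (at x within T) (hd us))"

text \<open>
  The wedge product of a list of \<open>1\<close>-forms, normalized so that
  \<open>(\<alpha>\<^sub>1 \<and> \<dots> \<and> \<alpha>\<^sub>k) (u\<^sub>1, \<dots>, u\<^sub>k) = det (\<alpha>\<^sub>i (u\<^sub>j))\<close>.
\<close>

definition wedge ::
  "'a::real_vector set \<Rightarrow> ('a, 'f::field) form list \<Rightarrow> ('a, 'f) form" where
  "wedge T \<alpha>s = form_on T (length \<alpha>s) (\<lambda>x us.
     \<Sum>\<sigma> | \<sigma> permutes {..<length \<alpha>s}.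
       of_int (sign \<sigma>) * (\<Prod>i<length \<alpha>s. (\<alpha>s ! i) x [us ! \<sigma> i]))"

definition pullback ::
  "'a::real_normed_vector set \<Rightarrow> nat \<Rightarrow> ('a \<Rightarrow> 'a) \<Rightarrow> ('a, 'f::field) form \<Rightarrow> ('a, 'f) form" where
  "pullback T k S \<omega> =
     form_on T k (\<lambda>x us. \<omega> (S x) (map (frechet_derivative S (at x within T)) us))"


section \<open>Simplices\<close>

definition simplex_hull :: "nat \<Rightarrow> (nat \<Rightarrow> 'a::real_vector) \<Rightarrow> 'a set" where
  "simplex_hull n v = convex hull (v ` {..n})"

definition affine_on :: "'a::real_vector set \<Rightarrow> ('a \<Rightarrow> 'b::real_vector) \<Rightarrow> bool" where
  "affine_on T f \<longleftrightarrow> (\<forall>x\<in>T. \<forall>y\<in>T. \<forall>t\<in>{0..1}.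
     f ((1 - t) *\<^sub>R x + t *\<^sub>R y) = (1 - t) *\<^sub>R f x + t *\<^sub>R f y)"

text \<open>
  If the vertices are affinely independent, the following two functions exist and are unique on
  the simplex. Their values elsewhere are irrelevant.
\<close>

definition barycentric :: "nat \<Rightarrow> (nat \<Rightarrow> 'a::real_vector) \<Rightarrow> nat \<Rightarrow> 'a \<Rightarrow> real" where
  "barycentric n v i = (SOME f. affine_on (simplex_hull n v) f \<and>
     (\<forall>j\<le>n. f (v j) = (if i = j then 1 else 0)))"

definition simplex_map :: "nat \<Rightarrow> (nat \<Rightarrow> 'a::real_vector) \<Rightarrow> (nat \<Rightarrow> nat) \<Rightarrow> 'a \<Rightarrow> 'a" where
  "simplex_map n v \<pi> = (SOME S. affine_on (simplex_hull n v) S \<and>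
     (\<forall>i\<le>n. S (v i) = v (inv \<pi> i)))"

text \<open>The real form \<open>d\<lambda>\<^sub>i\<close>, read as a form with values in \<open>'f\<close>.\<close>

definition dlam ::
  "nat \<Rightarrow> (nat \<Rightarrow> 'a::real_normed_vector) \<Rightarrow> nat \<Rightarrow> ('a, 'f::real_normed_field) form" where
  "dlam n v i = ext_deriv (simplex_hull n v) (\<lambda>x. of_real (barycentric n v i x))"

definition constant_forms ::
  "nat \<Rightarrow> (nat \<Rightarrow> 'a::real_normed_vector) \<Rightarrow> nat \<Rightarrow> ('a, 'f::real_normed_field) form set" where
  "constant_forms n v k = forms.span
     {wedge (simplex_hull n v) (map (dlam n v) is) | is. length is = k \<and> set is \<subseteq> {..n}}"

definition invariant_forms ::
  "nat \<Rightarrow> (nat \<Rightarrow> 'a::real_normed_vector) \<Rightarrow> nat \<Rightarrow> ('a, 'f::real_normed_field) form list \<Rightarrow> bool"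
  where
  "invariant_forms n v k \<omega>s \<longleftrightarrow> distinct \<omega>s \<and>
     (\<forall>\<pi>. \<pi> permutes {..n} \<longrightarrow>
       (\<exists>\<tau> c. \<tau> permutes {..<length \<omega>s} \<and>
         (\<forall>i<length \<omega>s. norm (c i) = 1 \<and>
           pullback (simplex_hull n v) k (simplex_map n v \<pi>) (\<omega>s ! i) =
             scale_form (c i) (\<omega>s ! \<tau> i))))"

definition invariant_basis ::
  "nat \<Rightarrow> (nat \<Rightarrow> 'a::real_normed_vector) \<Rightarrow> nat \<Rightarrow> ('a, 'f::real_normed_field) form list \<Rightarrow> bool"
  where
  "invariant_basis n v k \<omega>s \<longleftrightarrow> invariant_forms n v k \<omega>s \<and>
     forms.independent (set \<omega>s) \<and> forms.span (set \<omega>s) = constant_forms n v k"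

definition psi_w :: "(nat \<Rightarrow> 'a::real_normed_vector) \<Rightarrow> ('a, 'f::real_normed_field) form" where
  "psi_w v = dlam 3 v 0 - dlam 3 v 1 + dlam 3 v 2 - dlam 3 v 3"

definition psi_p :: "(nat \<Rightarrow> 'a::real_normed_vector) \<Rightarrow> ('a, 'f::real_normed_field) form" where
  "psi_p v = dlam 3 v 0 + dlam 3 v 1 - dlam 3 v 2 - dlam 3 v 3"

definition psi_k :: "(nat \<Rightarrow> 'a::real_normed_vector) \<Rightarrow> ('a, 'f::real_normed_field) form" where
  "psi_k v = dlam 3 v 0 - dlam 3 v 1 - dlam 3 v 2 + dlam 3 v 3"

end

theory Submission
  imports Defs
begin

text \<open>
  The coefficient vectors of \<open>\<psi>\<^sub>w\<close>, \<open>\<psi>\<^sub>p\<close>, \<open>\<psi>\<^sub>k\<close> are orthogonal, and up to sign they are the only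
  vectors in \<open>{1, -1}\<^sup>4\<close> with sum \<open>0\<close>. As \<open>S\<^sub>\<pi>\<close> pulls \<open>d\<lambda>\<^sub>i\<close> back to \<open>d\<lambda>\<^sub>\<pi>\<^sub>(\<^sub>i\<^sub>)\<close>, every permutation of the
  vertices permutes the three \<open>1\<close>-forms up to sign, hence also their pairwise wedge products.
  Orthogonality provides dual tangent vectors, which give independence, and, with
  \<open>\<Sum>\<^sub>i d\<lambda>\<^sub>i = 0\<close>, expresses each \<open>d\<lambda>\<^sub>i\<close> through \<open>\<psi>\<^sub>w\<close>, \<open>\<psi>\<^sub>p\<close>, \<open>\<psi>\<^sub>k\<close>.
\<close>

section \<open>Affine maps on convex sets and their derivatives\<close>

lemma affine_on_linear_plus:
  assumes "linear g"
  shows "affine_on T (\<lambda>x. g x + c)"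
  unfolding affine_on_def
  by (auto simp: linear_add[OF assms] linear_diff[OF assms] linear_scale[OF assms] algebra_simps)

text \<open>The points where \<open>f\<close> and the affine map agree form a convex set containing
  \<open>S\<close>. This extends vertex data to the whole simplex for functions that are known only
  through a choice.\<close>

lemma affine_on_convex_hull_eqI:
  assumes f: "affine_on (convex hull S) f" and g: "linear g"
    and eq: "\<And>s. s \<in> S \<Longrightarrow> f s = g s + c" and x: "x \<in> convex hull S"
  shows "f x = g x + c"
proof -
  let ?A = "{x \<in> convex hull S. f x = g x + c}"
  have "(1 - u) *\<^sub>R x + u *\<^sub>R y \<in> ?A"
    if xy: "x \<in> ?A" "y \<in> ?A" and u: "0 \<le> u \<and> u \<le> 1" for x y u
  proof -
    have "(1 - u) *\<^sub>R x + u *\<^sub>R y \<in> convex hull S"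
      using convex_convex_hull[of S] xy u unfolding convex_alt by blast
    moreover have "f ((1 - u) *\<^sub>R x + u *\<^sub>R y) = (1 - u) *\<^sub>R (g x + c) + u *\<^sub>R (g y + c)"
      using f xy u unfolding affine_on_def by auto
    moreover have "\<dots> = g ((1 - u) *\<^sub>R x + u *\<^sub>R y) + c"
      by (simp add: linear_add[OF g] linear_diff[OF g] linear_scale[OF g] algebra_simps)
    ultimately show ?thesis by simp
  qed
  then have "convex ?A" unfolding convex_alt by blast
  moreover have "S \<subseteq> ?A" using eq hull_subset[of S convex] by auto
  ultimately have "convex hull S \<subseteq> ?A" by (intro hull_minimal)
  with x show ?thesis by auto
qed

text \<open>\<open>T\<close> may have empty interior, so full uniqueness of the derivative can fail.
  Along the segment from \<open>x\<close> to \<open>y\<close> the problem becomes a one-variable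
  derivative at 0 within \<open>{0..1}\<close>, which is unique because 0 is a limit point of that
  interval.\<close>

lemma has_derivative_segment_unique:
  fixes f :: "'a::real_normed_vector \<Rightarrow> 'b::real_normed_vector"
  assumes T: "convex T" "x \<in> T" "y \<in> T"
    and D: "(f has_derivative D) (at x within T)" and D': "(f has_derivative D') (at x within T)"
  shows "D (y - x) = D' (y - x)"
proof -
  let ?h = "\<lambda>t::real. x + t *\<^sub>R (y - x)"
  have h: "?h ` {0..1} \<subseteq> T"
    using T unfolding convex_alt by (auto simp: algebra_simps)
  have *: "((\<lambda>t. f (?h t)) has_vector_derivative E (y - x)) (at 0 within {0..1})"
    if "(f has_derivative E) (at x within T)" for E
  proof -
    have "(?h has_derivative (\<lambda>t. t *\<^sub>R (y - x))) (at 0 within {0..1})"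
      by (auto intro!: derivative_eq_intros)
    moreover have "(f has_derivative E) (at (?h 0) within ?h ` {0..1})"
      using has_derivative_subset[OF that h] by simp
    ultimately have "(f \<circ> ?h has_derivative E \<circ> (\<lambda>t. t *\<^sub>R (y - x))) (at 0 within {0..1})"
      by (rule diff_chain_within)
    moreover have "E \<circ> (\<lambda>t. t *\<^sub>R (y - x)) = (\<lambda>t. t *\<^sub>R E (y - x))"
      using linear_scale[OF has_derivative_linear[OF that]] by auto
    ultimately show ?thesis by (simp add: has_vector_derivative_def o_def)
  qed
  have "(0::real) islimpt {0..1}"
    by (simp add: islimpt_Icc)
  then have "at (0::real) within {0..1} \<noteq> bot"
    by (simp add: trivial_limit_within)
  then show ?thesis
    using vector_derivative_unique_within[OF _ *[OF D] *[OF D']] by simp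
qed

text \<open>\<open>frechet_derivative\<close> is a choice among possible derivatives. All of them
  agree in the directions from \<open>x\<close> to points of \<open>T\<close>, hence by linearity on
  the tangent space.\<close>

lemma frechet_derivative_affine:
  fixes f :: "'a::real_normed_vector \<Rightarrow> 'b::real_normed_vector"
  assumes T: "convex T" "x \<in> T" and g: "bounded_linear g"
    and f: "\<And>y. y \<in> T \<Longrightarrow> f y = g y + c" and u: "u \<in> tangent_space T"
  shows "frechet_derivative f (at x within T) u = g u"
proof -
  let ?D = "frechet_derivative f (at x within T)"
  have "((\<lambda>y. g y + c) has_derivative g) (at x within T)"
    by (auto intro!: derivative_eq_intros bounded_linear_imp_has_derivative g)
  then have Df: "(f has_derivative g) (at x within T)"
    using f T by (auto intro: has_derivative_transform)
  then have DD: "(f has_derivative ?D) (at x within T)"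
    using differentiableI frechet_derivative_works by blast
  note lin = has_derivative_linear[OF DD] bounded_linear.linear[OF g]
  have "?D (y - z) = g (y - z)" if "y \<in> T" "z \<in> T" for y z
  proof -
    \<comment> \<open>Uniqueness covers only segments starting at \<open>x\<close>, so the
      difference of two arbitrary points is routed through \<open>x\<close>.\<close>
    have "?D ((y - x) - (z - x)) = g ((y - x) - (z - x))"
      using has_derivative_segment_unique[OF T _ DD Df] that
      by (simp only: linear_diff[OF lin(1), of "y - x"] linear_diff[OF lin(2), of "y - x"])
    then show ?thesis by simp
  qed
  then show ?thesis
    using u linear_eq_on_span[OF lin, of "{x - y | x y. x \<in> T \<and> y \<in> T}"]
    unfolding tangent_space_def by blast
qed

section \<open>Wedge products of constant 1-forms\<close>

lemma sum_form_apply: "(\<Sum>i\<in>A. F i) x us = (\<Sum>i\<in>A. F i x us)"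
  for F :: "'i \<Rightarrow> ('a, 'f::field) form"
  by (induction A rule: infinite_finite_induct) simp_all

definition covector :: "'a::real_vector set \<Rightarrow> ('a \<Rightarrow> 'f::field) \<Rightarrow> ('a, 'f) form" where
  "covector T \<phi> = form_on T 1 (\<lambda>x us. \<phi> (hd us))"

text \<open>This closed 2 by 2 determinant replaces the permutation sum of \<open>wedge\<close> in
  all later calculations.\<close>

definition wedge2 :: "'a::real_vector set \<Rightarrow> ('a \<Rightarrow> 'f::field) \<Rightarrow> ('a \<Rightarrow> 'f) \<Rightarrow> ('a, 'f) form" where
  "wedge2 T \<phi> \<theta> = form_on T 2 (\<lambda>x us. \<phi> (us ! 0) * \<theta> (us ! 1) - \<phi> (us ! 1) * \<theta> (us ! 0))"

lemma wedge_covector: "wedge T [covector T \<phi>, covector T \<theta>] = wedge2 T \<phi> \<theta>"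
proof -
  have fin: "finite {1::nat}" "0 \<notin> {1::nat}" by auto
  \<comment> \<open>In this shape the sum over permutations splits into the identity and the
    transposition of 0 and 1.\<close>
  have two: "{..<2::nat} = insert 0 {1}" by auto
  have "(\<Sum>\<sigma> | \<sigma> permutes {..<2}. of_int (sign \<sigma>) *
      (\<Prod>i<2. ([covector T \<phi>, covector T \<theta>] ! i) x [us ! \<sigma> i])) =
      \<phi> (us ! 0) * \<theta> (us ! 1) - \<phi> (us ! 1) * \<theta> (us ! 0)"
    if "x \<in> T" "length us = 2" "set us \<subseteq> tangent_space T" for x us
  proof -
    have "us ! 0 \<in> tangent_space T" "us ! 1 \<in> tangent_space T"
      using that nth_mem[of _ us] by auto
    then show ?thesis
      unfolding two sum_over_permutations_insert[OF fin] permutes_sing using that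
      by (simp add: sign_swap_id sign_id covector_def form_on_def)
  qed
  then show ?thesis
    unfolding wedge_def wedge2_def form_on_def by (auto simp: fun_eq_iff numeral_2_eq_2)
qed

lemma wedge2_cong:
  assumes "\<And>u. u \<in> tangent_space T \<Longrightarrow> \<phi> u = \<phi>' u" "\<And>u. u \<in> tangent_space T \<Longrightarrow> \<theta> u = \<theta>' u"
  shows "wedge2 T \<phi> \<theta> = wedge2 T \<phi>' \<theta>'"
  using assms by (auto simp: wedge2_def form_on_def fun_eq_iff subset_eq all_set_conv_all_nth)

lemma wedge2_scale:
  "wedge2 T (\<lambda>u. a * \<phi> u) (\<lambda>u. b * \<theta> u) = scale_form (a * b) (wedge2 T \<phi> \<theta>)"
  by (auto simp: wedge2_def form_on_def scale_form_def fun_eq_iff algebra_simps)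

lemma wedge2_swap: "wedge2 T \<theta> \<phi> = scale_form (- 1) (wedge2 T \<phi> \<theta>)"
  by (auto simp: wedge2_def form_on_def scale_form_def fun_eq_iff algebra_simps)

lemma wedge2_self: "wedge2 T \<phi> \<phi> = 0"
  by (auto simp: wedge2_def form_on_def fun_eq_iff)

text \<open>Bilinearity, needed in both directions of the change between the \<open>lam\<close> and
  the \<open>psi\<close> functionals.\<close>

lemma wedge2_sum:
  fixes \<phi> :: "'i \<Rightarrow> 'a::real_vector \<Rightarrow> 'f::field"
  shows "wedge2 T (\<lambda>u. \<Sum>i\<in>A. a i * \<phi> i u) (\<lambda>u. \<Sum>j\<in>B. b j * \<theta> j u) =
     (\<Sum>i\<in>A. \<Sum>j\<in>B. scale_form (a i * b j) (wedge2 T (\<phi> i) (\<theta> j)))"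
proof -
  have product: "(\<Sum>i\<in>A. a i * \<phi> i u) * (\<Sum>j\<in>B. b j * \<theta> j w) - (\<Sum>i\<in>A. a i * \<phi> i w) * (\<Sum>j\<in>B. b j * \<theta> j u) =
      (\<Sum>i\<in>A. \<Sum>j\<in>B. a i * b j * (\<phi> i u * \<theta> j w - \<phi> i w * \<theta> j u))" for u w
    unfolding sum_product sum_subtractf[symmetric] by (intro sum.cong refl) (simp add: algebra_simps)
  show ?thesis
  proof (intro ext)
    fix x us
    show "wedge2 T (\<lambda>u. \<Sum>i\<in>A. a i * \<phi> i u) (\<lambda>u. \<Sum>j\<in>B. b j * \<theta> j u) x us =
        (\<Sum>i\<in>A. \<Sum>j\<in>B. scale_form (a i * b j) (wedge2 T (\<phi> i) (\<theta> j))) x us"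
    proof (cases "x \<in> T \<and> length us = 2 \<and> set us \<subseteq> tangent_space T")
      case True
      then show ?thesis by (simp add: wedge2_def form_on_def scale_form_def sum_form_apply product)
    next
      case False
      then have "wedge2 T f g x us = 0" for f g :: "'a \<Rightarrow> 'f"
        unfolding wedge2_def form_on_def by (rule if_not_P)
      then show ?thesis by (simp add: scale_form_def sum_form_apply)
    qed
  qed
qed

lemma wedge2_sum_in_span:
  assumes "\<And>i j. i \<in> A \<Longrightarrow> j \<in> B \<Longrightarrow> wedge2 T (\<phi> i) (\<theta> j) \<in> forms.span S"
  shows "wedge2 T (\<lambda>u. \<Sum>i\<in>A. a i * \<phi> i u) (\<lambda>u. \<Sum>j\<in>B. b j * \<theta> j u) \<in> forms.span S"
  unfolding wedge2_sum by (intro forms.span_sum forms.span_scale assms)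

text \<open>The derivative of \<open>S\<close> is the same map \<open>M\<close> at every point, so
  pulling back a constant form is composition with \<open>M\<close>. The first two assumptions keep
  the arguments where the inner \<open>form_on\<close> does not return its default 0.\<close>

lemma pullback_wedge2:
  assumes "\<And>x. x \<in> T \<Longrightarrow> S x \<in> T"
    and "\<And>u. u \<in> tangent_space T \<Longrightarrow> M u \<in> tangent_space T"
    and "\<And>x u. x \<in> T \<Longrightarrow> u \<in> tangent_space T \<Longrightarrow> frechet_derivative S (at x within T) u = M u"
  shows "pullback T 2 S (wedge2 T \<phi> \<theta>) = wedge2 T (\<lambda>u. \<phi> (M u)) (\<lambda>u. \<theta> (M u))"
  using assms
  by (auto simp: pullback_def wedge2_def form_on_def fun_eq_iff subset_eq all_set_conv_all_nth)

text \<open>Evaluation at \<open>x\<close> and \<open>us i\<close> is a linear functional on forms,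
  and the matrix of these functionals on the list is \<open>c\<close> times the identity. Two equal
  entries at different positions would force \<open>c = 0\<close>, hence distinctness.\<close>

lemma independent_forms_if_biorthogonal:
  fixes \<omega>s :: "('a, 'f::field) form list"
  assumes "c \<noteq> 0"
    and eval: "\<And>i j. i < length \<omega>s \<Longrightarrow> j < length \<omega>s \<Longrightarrow> (\<omega>s ! j) x (us i) = (if i = j then c else 0)"
  shows "distinct \<omega>s" "forms.independent (set \<omega>s)"
proof -
  show dist: "distinct \<omega>s"
    unfolding distinct_conv_nth using assms by metis
  show "forms.independent (set \<omega>s)"
  proof
    assume "forms.dependent (set \<omega>s)"
    then obtain a where "\<exists>\<omega>\<in>set \<omega>s. a \<omega> \<noteq> 0" and sum: "(\<Sum>\<omega>\<in>set \<omega>s. scale_form (a \<omega>) \<omega>) = 0"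
      by (auto simp: forms.dependent_finite)
    then obtain i where i: "i < length \<omega>s" "a (\<omega>s ! i) \<noteq> 0" by (auto simp: in_set_conv_nth)
    have "0 = (\<Sum>\<omega>\<in>set \<omega>s. scale_form (a \<omega>) \<omega>) x (us i)" using sum by simp
    also have "\<dots> = (\<Sum>\<omega>\<in>set \<omega>s. a \<omega> * \<omega> x (us i))" by (simp add: sum_form_apply scale_form_def)
    also have "\<dots> = (\<Sum>j<length \<omega>s. a (\<omega>s ! j) * (\<omega>s ! j) x (us i))"
      by (rule sum.reindex_bij_betw[OF bij_betw_nth[OF dist refl refl], symmetric])
    also have "\<dots> = (\<Sum>j<length \<omega>s. if j = i then a (\<omega>s ! j) * c else 0)"
      using i eval by (intro sum.cong) auto
    also have "\<dots> = a (\<omega>s ! i) * c" using i by simp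
    finally show False using i \<open>c \<noteq> 0\<close> by simp
  qed
qed

section \<open>Simplices: tangent space, barycentric coordinates and vertex permutations\<close>

text \<open>Affine independence concerns only the set of vertices and does not exclude repetitions
  in \<open>v\<close>; injectivity does.\<close>

locale simplex =
  fixes n :: nat and v :: "nat \<Rightarrow> 'a::euclidean_space"
  assumes inj: "inj_on v {..n}" and indep: "\<not> affine_dependent (v ` {..n})"
begin

abbreviation T where "T \<equiv> simplex_hull n v"

lemma convex_T: "convex T"
  by (simp add: simplex_hull_def)

lemma vertex_in_T: "i \<le> n \<Longrightarrow> v i \<in> T"
  by (simp add: simplex_hull_def hull_inc)

text \<open>The translate by \<open>v 0\<close> of the span of the edge vectors is convex and
  contains all vertices, hence all of \<open>T\<close>.\<close>

lemma tangent_space_eq: "tangent_space T = span ((\<lambda>i. v i - v 0) ` {..n})"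
proof -
  let ?V = "span ((\<lambda>i. v i - v 0) ` {..n})"
  have *: "x - v 0 \<in> ?V" if "x \<in> T" for x
  proof -
    have "convex ((+) (v 0) ` ?V)" by (intro convex_translation subspace_imp_convex subspace_span)
    moreover have "v ` {..n} \<subseteq> (+) (v 0) ` ?V"
    proof
      fix y assume "y \<in> v ` {..n}"
      then have "y - v 0 \<in> ?V" by (auto intro: span_base)
      then show "y \<in> (+) (v 0) ` ?V" by (metis add_diff_cancel_left' diff_add_cancel image_iff add.commute)
    qed
    ultimately have "T \<subseteq> (+) (v 0) ` ?V" unfolding simplex_hull_def by (intro hull_minimal)
    with that show ?thesis by auto
  qed
  have "x - y \<in> ?V" if "x \<in> T" "y \<in> T" for x y
    using span_diff[OF *[OF that(1)] *[OF that(2)]] by simp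
  then have "tangent_space T \<subseteq> ?V"
    unfolding tangent_space_def by (intro span_minimal subspace_span) auto
  moreover have "?V \<subseteq> tangent_space T"
    unfolding tangent_space_def by (intro span_mono) (auto intro: vertex_in_T)
  ultimately show ?thesis by auto
qed

lemma tangent_vertex_diff: "i \<le> n \<Longrightarrow> j \<le> n \<Longrightarrow> v i - v j \<in> tangent_space T"
  unfolding tangent_space_def by (auto intro!: span_base vertex_in_T)

lemma linear_eq_on_tangent:
  assumes "linear f" "linear g" "u \<in> tangent_space T"
    and "\<And>i. i \<le> n \<Longrightarrow> f (v i - v 0) = g (v i - v 0)"
  shows "f u = g u"
  using assms(3) linear_eq_on_span[OF assms(1,2), of "(\<lambda>i. v i - v 0) ` {..n}"] assms(4)
  unfolding tangent_space_eq by blast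

text \<open>The edge vectors at \<open>v 0\<close> are independent, so a linear map may take any
  values on them; the added constant then corrects the value at \<open>v 0\<close>.\<close>

lemma linear_interpolation:
  fixes w :: "nat \<Rightarrow> 'b::real_vector"
  obtains g where "linear g" "\<And>i. i \<le> n \<Longrightarrow> g (v i) + (w 0 - g (v 0)) = w i"
proof -
  \<comment> \<open>\<open>?h\<close> recovers the vertex index from an edge vector \<open>u\<close>
    and returns the increment of \<open>w\<close> prescribed there.\<close>
  let ?h = "\<lambda>u. w (inv_into {..n} v (v 0 + u)) - w 0"
  have "independent ((\<lambda>x. - v 0 + x) ` (v ` {..n} - {v 0}))"
    using indep affine_dependent_iff_dependent2[of "v 0" "v ` {..n}"] by auto
  then obtain g where g: "linear g"
    "\<And>u. u \<in> (\<lambda>x. - v 0 + x) ` (v ` {..n} - {v 0}) \<Longrightarrow> g u = ?h u"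
    using linear_independent_extend[of _ ?h] by blast
  have "g (v i) + (w 0 - g (v 0)) = w i" if "i \<le> n" for i
  proof (cases "v i = v 0")
    case True
    then have "i = 0" using inj that by (auto dest: inj_onD)
    then show ?thesis by simp
  next
    case False
    then have "g (- v 0 + v i) = ?h (- v 0 + v i)" using that by (intro g(2)) auto
    then have "g (v i - v 0) = w i - w 0" using that inj by (simp add: inv_into_f_f)
    then show ?thesis using linear_diff[OF g(1), of "v i" "v 0"] by (simp add: algebra_simps)
  qed
  with g(1) that show thesis by blast
qed

text \<open>The linear functional underlying \<open>d\<lambda>\<^sub>i\<close>; only its values on the tangent space are determined.\<close>

definition lam :: "nat \<Rightarrow> 'a \<Rightarrow> real" where
  "lam i = (SOME g. linear g \<and> (\<exists>c. \<forall>j\<le>n. g (v j) + c = (if i = j then 1 else 0)))"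

lemma linear_lam: "linear (lam i)"
  and lam_vertex: "\<exists>c. \<forall>j\<le>n. lam i (v j) + c = (if i = j then 1 else 0)"
proof -
  obtain g where "linear g"
    "\<And>j. j \<le> n \<Longrightarrow> g (v j) + ((if i = 0 then 1 else 0) - g (v 0)) = (if i = j then 1 else (0::real))"
    using linear_interpolation[of "\<lambda>j. if i = j then 1 else 0"] by auto
  then have "linear g \<and> (\<exists>c. \<forall>j\<le>n. g (v j) + c = (if i = j then 1 else 0))"
    by blast
  then have "\<exists>g :: 'a \<Rightarrow> real. linear g \<and> (\<exists>c. \<forall>j\<le>n. g (v j) + c = (if i = j then 1 else 0))"
    by (rule exI[where x = g])
  from someI_ex[OF this] show "linear (lam i)"
    "\<exists>c. \<forall>j\<le>n. lam i (v j) + c = (if i = j then 1 else 0)"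
    unfolding lam_def by auto
qed

lemma lam_vertex_diff:
  assumes "j \<le> n" "k \<le> n"
  shows "lam i (v j - v k) = of_bool (i = j) - of_bool (i = k)"
proof -
  obtain c where c: "\<forall>j\<le>n. lam i (v j) + c = (if i = j then 1 else 0)" using lam_vertex by blast
  then have "lam i (v j) = of_bool (i = j) - c" "lam i (v k) = of_bool (i = k) - c"
    using assms by (simp_all add: algebra_simps)
  then show ?thesis by (simp add: linear_diff[OF linear_lam])
qed

text \<open>The affine function built from \<open>lam i\<close> shows that the choice in
  \<open>barycentric\<close> has a witness; agreement at the vertices then spreads over the convex
  hull.\<close>

lemma barycentric_eq: "\<exists>c. \<forall>x\<in>T. barycentric n v i x = lam i x + c"
proof -
  let ?P = "\<lambda>f. affine_on T f \<and> (\<forall>j\<le>n. f (v j) = (if i = j then 1 else (0::real)))"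
  obtain c where c: "\<forall>j\<le>n. lam i (v j) + c = (if i = j then 1 else 0)" using lam_vertex by blast
  then have "?P (\<lambda>x. lam i x + c)" using affine_on_linear_plus[OF linear_lam] by auto
  then have P: "?P (barycentric n v i)" unfolding barycentric_def by (rule someI[where P = ?P])
  then have "barycentric n v i s = lam i s + c" if "s \<in> v ` {..n}" for s
    using that c by (metis atMost_iff image_iff)
  then have "barycentric n v i x = lam i x + c" if "x \<in> T" for x
    using that P affine_on_convex_hull_eqI[OF _ linear_lam] unfolding simplex_hull_def by blast
  then show ?thesis by blast
qed

text \<open>A vertex combination with coefficient sum 0 is a combination of edge vectors, and
  \<open>lam j\<close> reads off its coefficients. This later supplies the dual tangent
  vectors.\<close>

lemma lam_combination:
  assumes "sum a {..n} = 0"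
  shows "(\<Sum>i\<le>n. a i *\<^sub>R v i) \<in> tangent_space T"
    and "j \<le> n \<Longrightarrow> lam j (\<Sum>i\<le>n. a i *\<^sub>R v i) = a j"
proof -
  have *: "(\<Sum>i\<le>n. a i *\<^sub>R v i) = (\<Sum>i\<le>n. a i *\<^sub>R (v i - v 0))"
    using assms by (simp add: scaleR_diff_right sum_subtractf flip: scaleR_sum_left)
  show "(\<Sum>i\<le>n. a i *\<^sub>R v i) \<in> tangent_space T"
    unfolding * tangent_space_eq by (intro span_sum span_scale span_base) auto
  assume "j \<le> n"
  have "lam j (\<Sum>i\<le>n. a i *\<^sub>R v i) = (\<Sum>i\<le>n. a i * (of_bool (j = i) - of_bool (j = 0)))"
    unfolding * by (simp add: linear_sum[OF linear_lam] linear_scale[OF linear_lam] lam_vertex_diff)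
  also have "\<dots> = (\<Sum>i\<le>n. a i * of_bool (j = i)) - sum a {..n} * of_bool (j = 0)"
    by (simp add: right_diff_distrib sum_subtractf sum_distrib_right)
  also have "\<dots> = a j" using assms \<open>j \<le> n\<close> by (simp add: of_bool_def if_distrib cong: if_cong)
  finally show "lam j (\<Sum>i\<le>n. a i *\<^sub>R v i) = a j" .
qed

lemma sum_lam:
  assumes "u \<in> tangent_space T"
  shows "(\<Sum>i\<le>n. lam i u) = 0"
proof (rule linear_eq_on_tangent[OF _ _ assms])
  show "linear (\<lambda>u. \<Sum>i\<le>n. lam i u)" by (intro linear_compose_sum) (auto intro: linear_lam)
  show "linear (\<lambda>u::'a. 0::real)" by (rule linear_zero)
qed (simp add: lam_vertex_diff sum_subtractf of_bool_def)

lemma dlam_eq: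
  "(dlam n v i :: ('a, 'f::real_normed_field) form) = covector T (\<lambda>u. of_real (lam i u))"
proof -
  obtain c where c: "\<forall>x\<in>T. barycentric n v i x = lam i x + c" using barycentric_eq by blast
  have "bounded_linear (\<lambda>x. of_real (lam i x) :: 'f)"
    by (intro bounded_linear_compose[OF bounded_linear_of_real] linear_conv_bounded_linear[THEN iffD1] linear_lam)
  then have "frechet_derivative (\<lambda>x. of_real (barycentric n v i x) :: 'f) (at x within T) u = of_real (lam i u)"
    if "x \<in> T" "u \<in> tangent_space T" for x u
    using c that by (intro frechet_derivative_affine[OF convex_T, where c = "of_real c"]) auto
  then show ?thesis
    unfolding dlam_def ext_deriv_def covector_def form_on_def
    by (auto simp: fun_eq_iff length_Suc_conv)
qed

text \<open>\<open>M\<close> is the linear part of the affine extension of the vertex permutation.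
  The rule for \<open>lam i (M u)\<close> is the pullback of \<open>d\<lambda>\<close> in terms of
  functionals, and it suffices to check it on edge vectors.\<close>

lemma simplex_map_derivative:
  assumes \<pi>: "\<pi> permutes {..n}"
  obtains M where "\<And>u. u \<in> tangent_space T \<Longrightarrow> M u \<in> tangent_space T"
    and "\<And>i u. i \<le> n \<Longrightarrow> u \<in> tangent_space T \<Longrightarrow> lam i (M u) = lam (\<pi> i) u"
    and "\<And>x. x \<in> T \<Longrightarrow> simplex_map n v \<pi> x \<in> T"
    and "\<And>x u. x \<in> T \<Longrightarrow> u \<in> tangent_space T \<Longrightarrow>
           frechet_derivative (simplex_map n v \<pi>) (at x within T) u = M u"
proof -
  let ?S = "simplex_map n v \<pi>"
  have inv_le: "inv \<pi> i \<le> n" if "i \<le> n" for i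
    using permutes_in_image[OF permutes_inv[OF \<pi>], of i] that by simp
  let ?P = "\<lambda>S. affine_on T S \<and> (\<forall>i\<le>n. S (v i) = v (inv \<pi> i))"
  obtain M where "linear M" "\<And>i. i \<le> n \<Longrightarrow> M (v i) + (v (inv \<pi> 0) - M (v 0)) = v (inv \<pi> i)"
    using linear_interpolation[of "\<lambda>i. v (inv \<pi> i)"] by blast
  then obtain c where M: "linear M" "\<And>i. i \<le> n \<Longrightarrow> M (v i) + c = v (inv \<pi> i)"
    by blast
  have "?P (\<lambda>x. M x + c)" by (intro conjI affine_on_linear_plus allI impI M)
  then have P: "?P ?S" unfolding simplex_map_def by (rule someI[where P = ?P])
  then have "?S s = M s + c" if "s \<in> v ` {..n}" for s
    using that M(2) by (metis atMost_iff image_iff)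
  then have S: "?S x = M x + c" if "x \<in> T" for x
    using that P affine_on_convex_hull_eqI[OF _ M(1)] unfolding simplex_hull_def by blast
  have Mdiff: "M (v i - v j) = v (inv \<pi> i) - v (inv \<pi> j)" if "i \<le> n" "j \<le> n" for i j
    unfolding linear_diff[OF M(1)] M(2)[OF that(1), symmetric] M(2)[OF that(2), symmetric] by simp
  have 1: "M u \<in> tangent_space T" if "u \<in> tangent_space T" for u
  proof -
    have "M ` tangent_space T = span (M ` (\<lambda>i. v i - v 0) ` {..n})"
      unfolding tangent_space_eq by (rule linear_span_image[OF M(1), symmetric])
    also have "\<dots> \<subseteq> span (tangent_space T)"
      by (intro span_mono) (auto simp: Mdiff intro!: tangent_vertex_diff inv_le)
    finally show ?thesis using that unfolding tangent_space_def by (auto simp: span_span)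
  qed
  have 2: "lam i (M u) = lam (\<pi> i) u" if "i \<le> n" "u \<in> tangent_space T" for i u
  proof (rule linear_eq_on_tangent[OF _ linear_lam that(2)])
    show "linear (\<lambda>u. lam i (M u))"
      using linear_compose[OF M(1) linear_lam] by (simp add: o_def)
    have eq: "(i = inv \<pi> j) = (\<pi> i = j)" for j using permutes_inverses[OF \<pi>] by metis
    show "lam i (M (v j - v 0)) = lam (\<pi> i) (v j - v 0)" if "j \<le> n" for j
      using that by (simp add: Mdiff lam_vertex_diff inv_le eq)
  qed
  have 3: "?S x \<in> T" if "x \<in> T" for x
  proof -
    have "convex ((\<lambda>x. M x + c) -` T)"
    proof -
      \<comment> \<open>Moving the constant to the other side turns an affine preimage into a linear
        one, for which convexity is available.\<close>
      have "(\<lambda>x. M x + c) -` T = M -` ((+) (- c) ` T)" by (force simp: image_iff algebra_simps)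
      then show ?thesis using M(1) convex_T by (auto intro: convex_linear_vimage convex_translation)
    qed
    moreover have "v ` {..n} \<subseteq> (\<lambda>x. M x + c) -` T" using M(2) by (auto intro!: vertex_in_T inv_le)
    ultimately have "T \<subseteq> (\<lambda>x. M x + c) -` T" by (subst simplex_hull_def) (intro hull_minimal)
    with that S show ?thesis by auto
  qed
  have 4: "frechet_derivative ?S (at x within T) u = M u" if "x \<in> T" "u \<in> tangent_space T" for x u
    using frechet_derivative_affine[OF convex_T that(1) _ S that(2)] M(1)
    by (simp add: linear_conv_bounded_linear)
  from that[OF 1 2 3 4] show thesis .
qed

end

section \<open>Balanced sign vectors of length four\<close>

text \<open>
  The rows are the coefficients of \<open>\<psi>\<^sub>k\<close>, \<open>\<psi>\<^sub>p\<close> and \<open>\<psi>\<^sub>w\<close>, in this order, so that the \<open>m\<close>-th basis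
  form is, up to sign, the wedge product of the two forms other than the \<open>m\<close>-th.
\<close>

definition row :: "nat \<Rightarrow> nat \<Rightarrow> int" where
  "row m i = (if i = 0 \<or> i = [3, 1, 2] ! m then 1 else - 1)"

lemma less_3_cases: "m < 3 \<longleftrightarrow> m = 0 \<or> m = 1 \<or> m = (2::nat)"
  by auto

lemma le_3_cases: "i \<le> 3 \<longleftrightarrow> i = 0 \<or> i = 1 \<or> i = 2 \<or> i = (3::nat)"
  by auto

lemma atMost_3: "{..3::nat} = {0, 1, 2, 3}"
  by auto

lemma row_orthogonal:
  "m < 3 \<Longrightarrow> m' < 3 \<Longrightarrow> (\<Sum>i\<le>3. row m i * row m' i) = (if m = m' then 4 else 0)"
  by (auto simp: less_3_cases row_def atMost_3)

lemma row_sum: "m < 3 \<Longrightarrow> (\<Sum>i\<le>3. row m i) = 0"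
  by (auto simp: less_3_cases row_def atMost_3)

lemma row_values: "row m i \<in> {1, - 1}"
  by (simp add: row_def)

text \<open>Exactly one of the other three entries has the sign of \<open>f 0\<close>, and its
  position determines the row. As every row starts with 1, the factor is \<open>f 0\<close>.\<close>

lemma balanced_signs_eq_row:
  assumes "\<And>i. i \<le> 3 \<Longrightarrow> f i \<in> {1, - 1}" and "(\<Sum>i\<le>3. f i) = 0"
  obtains m s where "m < 3" "s \<in> {1, - 1}" "\<And>i. i \<le> 3 \<Longrightarrow> f i = s * row m i"
proof -
  have "f 0 = 1 \<or> f 0 = - 1" "f 1 = 1 \<or> f 1 = - 1" "f 2 = 1 \<or> f 2 = - 1" "f 3 = 1 \<or> f 3 = - 1"
    and "f 0 + f 1 + f 2 + f 3 = 0"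
    using assms by (auto simp: atMost_3)
  then consider "f 3 = f 0" "f 1 = - f 0" "f 2 = - f 0" | "f 1 = f 0" "f 2 = - f 0" "f 3 = - f 0" |
    "f 2 = f 0" "f 1 = - f 0" "f 3 = - f 0"
    by linarith
  then show thesis
  proof cases
    case 1
    then show thesis using assms by (intro that[of 0 "f 0"]) (auto simp: le_3_cases row_def)
  next
    case 2
    then show thesis using assms by (intro that[of 1 "f 0"]) (auto simp: le_3_cases row_def)
  next
    case 3
    then show thesis using assms by (intro that[of 2 "f 0"]) (auto simp: le_3_cases row_def)
  qed
qed

text \<open>Permuting coordinates keeps entries and sum, so each permuted row is again a row up to
  sign.\<close>

lemma row_permute:
  assumes \<pi>: "\<pi> permutes {..3}"
  obtains \<sigma> s where "\<sigma> permutes {..<3}" "\<And>m. m < 3 \<Longrightarrow> s m \<in> {1, - 1}"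
    and "\<And>m i. m < 3 \<Longrightarrow> i \<le> 3 \<Longrightarrow> row m (inv \<pi> i) = s m * row (\<sigma> m) i"
proof -
  have inv: "inv \<pi> permutes {..3}" by (rule permutes_inv[OF \<pi>])
  have reindex: "(\<Sum>i\<le>3. g (inv \<pi> i)) = (\<Sum>i\<le>3. g i)" for g :: "nat \<Rightarrow> int"
    using sum.permute[OF inv, of g] by (simp add: o_def)
  have "\<exists>m' s. m' < 3 \<and> s \<in> {1, - 1} \<and> (\<forall>i\<le>3. row m (inv \<pi> i) = s * row m' i)" if "m < 3" for m
    using balanced_signs_eq_row[of "\<lambda>i. row m (inv \<pi> i)"] row_values reindex[of "row m"] row_sum[OF that]
    by metis
  then obtain \<sigma>0 s where \<sigma>0: "\<And>m. m < 3 \<Longrightarrow> \<sigma>0 m < 3" and s: "\<And>m. m < 3 \<Longrightarrow> s m \<in> {1, - 1}"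
    and row: "\<And>m i. m < 3 \<Longrightarrow> i \<le> 3 \<Longrightarrow> row m (inv \<pi> i) = s m * row (\<sigma>0 m) i"
    by metis
  \<comment> \<open>Coordinate permutations preserve inner products: if two different rows had the
    same image up to sign, their inner product 0 would equal 4 or - 4.\<close>
  have "inj_on \<sigma>0 {..<3}"
  proof (rule inj_onI, rule ccontr)
    fix m m' assume m: "m \<in> {..<3}" "m' \<in> {..<3}" "\<sigma>0 m = \<sigma>0 m'" "m \<noteq> m'"
    have "0 = (\<Sum>i\<le>3. row m (inv \<pi> i) * row m' (inv \<pi> i))"
      using reindex[of "\<lambda>i. row m i * row m' i"] row_orthogonal[of m m'] m by simp
    also have "\<dots> = (\<Sum>i\<le>3. s m * s m' * (row (\<sigma>0 m) i * row (\<sigma>0 m) i))"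
      using m row by (intro sum.cong) (auto simp: algebra_simps)
    also have "\<dots> = s m * s m' * 4"
      using row_orthogonal[of "\<sigma>0 m" "\<sigma>0 m"] \<sigma>0 m by (simp flip: sum_distrib_left)
    finally show False using s[of m] s[of m'] m by auto
  qed
  \<comment> \<open>\<open>permutes\<close> demands the identity outside
    \<open>{..<3}\<close>.\<close>
  moreover define \<sigma> where "\<sigma> m = (if m < 3 then \<sigma>0 m else m)" for m
  ultimately have "\<sigma> permutes {..<3}"
    using \<sigma>0 by (intro inj_imp_permutes) (auto simp: inj_on_def)
  then show thesis using that[of \<sigma> s] s row by (auto simp: \<sigma>_def)
qed

section \<open>The three 1-forms on a tetrahedron and the invariance of their products\<close>

locale tetrahedron = simplex 3 v for v :: "nat \<Rightarrow> 'a::euclidean_space"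
begin

definition psi :: "nat \<Rightarrow> 'a \<Rightarrow> 'f::real_normed_field" where
  "psi m u = (\<Sum>i\<le>3. of_int (row m i) * of_real (lam i u))"

lemma psi_expand:
  "psi 0 u = of_real (lam 0 u) - of_real (lam 1 u) - of_real (lam 2 u) + of_real (lam 3 u)"
  "psi 1 u = of_real (lam 0 u) + of_real (lam 1 u) - of_real (lam 2 u) - of_real (lam 3 u)"
  "psi 2 u = of_real (lam 0 u) - of_real (lam 1 u) + of_real (lam 2 u) - of_real (lam 3 u)"
  by (simp_all add: psi_def row_def atMost_3)

lemma psi_eq:
  "psi_k v = covector T (psi 0)" "psi_p v = covector T (psi 1)" "psi_w v = covector T (psi 2)"
  unfolding psi_k_def psi_p_def psi_w_def dlam_eq
  by (simp_all add: covector_def form_on_def fun_eq_iff psi_expand[unfolded One_nat_def])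

definition basis :: "('a, 'f::real_normed_field) form list" where
  "basis = [wedge2 T (psi 2) (psi 1), wedge2 T (psi 2) (psi 0), wedge2 T (psi 1) (psi 0)]"

lemma basis_nth:
  "basis ! 0 = wedge2 T (psi 2) (psi 1)" "basis ! 1 = wedge2 T (psi 2) (psi 0)"
  "basis ! 2 = wedge2 T (psi 1) (psi 0)"
  by (simp_all add: basis_def)

text \<open>The basis forms all have the larger index first, so \<open>s\<close> can be 1 if
  \<open>b < a\<close> and - 1 if \<open>a < b\<close>.\<close>

lemma wedge2_psi:
  assumes "a < 3" "b < 3" "c < 3" "a \<noteq> b" "a \<noteq> c" "b \<noteq> c"
  obtains s where "norm s = 1"
    and "wedge2 T (psi a) (psi b) = scale_form s (basis ! c :: ('a, 'f::real_normed_field) form)"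
proof -
  have "(a, b, c) \<in> {(2, 1, 0), (1, 2, 0), (2, 0, 1), (0, 2, 1), (1, 0, 2), (0, 1, 2)}"
    using assms unfolding less_3_cases by auto
  then have "wedge2 T (psi a) (psi b) = (basis ! c :: ('a, 'f) form) \<or>
      wedge2 T (psi a) (psi b) = scale_form (- 1) (basis ! c :: ('a, 'f) form)"
    using wedge2_swap[of T "psi 0" "psi 1 :: _ \<Rightarrow> 'f"] wedge2_swap[of T "psi 0" "psi 2 :: _ \<Rightarrow> 'f"]
      wedge2_swap[of T "psi 1" "psi 2 :: _ \<Rightarrow> 'f"]
    by (elim insertE emptyE Pair_inject; simp add: basis_def)
  then show thesis using that[of 1] that[of "- 1"] by auto
qed

lemma pullback_psi:
  assumes s: "s \<in> {1, - 1}" and row: "\<And>i. i \<le> 3 \<Longrightarrow> row m (inv \<pi> i) = s * row m' i"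
    and \<pi>: "\<pi> permutes {..3}" and w: "\<And>i. i \<le> 3 \<Longrightarrow> lam i w = lam (\<pi> i) u"
  shows "psi m w = (of_int s * psi m' u :: 'f::real_normed_field)"
proof -
  \<comment> \<open>Writing \<open>i\<close> as \<open>inv \<pi> (\<pi> i)\<close> makes each
    summand a function of \<open>\<pi> i\<close>, ready for reindexing.\<close>
  have "psi m w = (\<Sum>i\<le>3. of_int (row m (inv \<pi> (\<pi> i))) * of_real (lam (\<pi> i) u) :: 'f)"
    unfolding psi_def by (intro sum.cong) (auto simp: w permutes_inverses[OF \<pi>])
  also have "\<dots> = (\<Sum>i\<le>3. of_int (row m (inv \<pi> i)) * of_real (lam i u))"
    using sum.permute[OF \<pi>, of "\<lambda>i. of_int (row m (inv \<pi> i)) * of_real (lam i u) :: 'f"] by (simp add: o_def)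
  also have "\<dots> = of_int s * psi m' u"
    unfolding psi_def sum_distrib_left by (intro sum.cong) (auto simp: row algebra_simps)
  finally show ?thesis .
qed

text \<open>Up to sign, the product omitting index \<open>i\<close> goes to the product omitting
  \<open>\<sigma> i\<close>. With basis forms numbered by the omitted index, the permutation of the
  1-forms is also that of the basis.\<close>

lemma pullback_basis:
  assumes \<pi>: "\<pi> permutes {..3}"
  obtains \<tau> c where "\<tau> permutes {..<3}"
    and "\<And>i. i < 3 \<Longrightarrow> norm (c i) = 1 \<and>
           pullback T 2 (simplex_map 3 v \<pi>) (basis ! i) =
             scale_form (c i) (basis ! \<tau> i :: ('a, 'f::real_normed_field) form)"
proof -
  obtain M where MT: "\<And>u. u \<in> tangent_space T \<Longrightarrow> M u \<in> tangent_space T"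
    and Mlam: "\<And>i u. i \<le> 3 \<Longrightarrow> u \<in> tangent_space T \<Longrightarrow> lam i (M u) = lam (\<pi> i) u"
    and S: "\<And>x. x \<in> T \<Longrightarrow> simplex_map 3 v \<pi> x \<in> T"
      "\<And>x u. x \<in> T \<Longrightarrow> u \<in> tangent_space T \<Longrightarrow>
           frechet_derivative (simplex_map 3 v \<pi>) (at x within T) u = M u"
    using simplex_map_derivative[OF \<pi>] by blast
  obtain \<sigma> s where \<sigma>: "\<sigma> permutes {..<3}" and s: "\<And>m. m < 3 \<Longrightarrow> s m \<in> {1, - 1}"
    and row: "\<And>m i. m < 3 \<Longrightarrow> i \<le> 3 \<Longrightarrow> row m (inv \<pi> i) = s m * row (\<sigma> m) i"
    using row_permute[OF \<pi>] by blast
  have psi: "psi m (M u) = of_int (s m) * psi (\<sigma> m) u" if "m < 3" "u \<in> tangent_space T" for m u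
    using pullback_psi[OF s[OF that(1)] row[OF that(1)] \<pi> Mlam[OF _ that(2)]] .
  have pair: "\<exists>c. norm c = 1 \<and> pullback T 2 (simplex_map 3 v \<pi>) (wedge2 T (psi a) (psi b)) =
      scale_form c (basis ! \<sigma> i :: ('a, 'f) form)"
    if abi: "a < 3" "b < 3" "i < 3" "a \<noteq> b" "a \<noteq> i" "b \<noteq> i" for a b i
  proof -
    have "\<sigma> a < 3" "\<sigma> b < 3" "\<sigma> i < 3" "\<sigma> a \<noteq> \<sigma> b" "\<sigma> a \<noteq> \<sigma> i" "\<sigma> b \<noteq> \<sigma> i"
      using abi permutes_in_image[OF \<sigma>] permutes_inj[OF \<sigma>] by (auto dest: injD)
    then obtain c where c: "norm c = 1"
      "wedge2 T (psi (\<sigma> a)) (psi (\<sigma> b)) = scale_form c (basis ! \<sigma> i :: ('a, 'f) form)"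
      by (rule wedge2_psi)
    have "pullback T 2 (simplex_map 3 v \<pi>) (wedge2 T (psi a) (psi b)) =
        wedge2 T (\<lambda>u. psi a (M u)) (\<lambda>u. psi b (M u) :: 'f)"
      by (rule pullback_wedge2[OF S(1) MT S(2)])
    also have "\<dots> = wedge2 T (\<lambda>u. of_int (s a) * psi (\<sigma> a) u) (\<lambda>u. of_int (s b) * psi (\<sigma> b) u)"
      using psi abi by (intro wedge2_cong) auto
    also have "\<dots> = scale_form (of_int (s a) * of_int (s b) * c) (basis ! \<sigma> i)"
      unfolding wedge2_scale c by simp
    finally show ?thesis
      using s[OF abi(1)] s[OF abi(2)] c(1)
      by (intro exI[of _ "of_int (s a) * of_int (s b) * c"]) (auto simp: norm_mult)
  qed
  have "\<exists>c. norm c = 1 \<and> pullback T 2 (simplex_map 3 v \<pi>) (basis ! i) =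
      scale_form c (basis ! \<sigma> i :: ('a, 'f) form)" if i: "i \<in> {..<3}" for i
  proof -
    consider "i = 0" | "i = 1" | "i = 2" using i by fastforce
    then show ?thesis
    proof cases
      case 1
      then show ?thesis using pair[of 2 1 0] by (simp only: basis_nth)
    next
      case 2
      then show ?thesis using pair[of 2 0 1] by (simp only: basis_nth)
    next
      case 3
      then show ?thesis using pair[of 1 0 2] by (simp only: basis_nth)
    qed
  qed
  then have "\<forall>i\<in>{..<3}. \<exists>c. norm c = 1 \<and> pullback T 2 (simplex_map 3 v \<pi>) (basis ! i) =
      scale_form c (basis ! \<sigma> i :: ('a, 'f) form)"
    by (rule ballI)
  then obtain c where "\<forall>i\<in>{..<3}. norm (c i) = 1 \<and> pullback T 2 (simplex_map 3 v \<pi>) (basis ! i) =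
      scale_form (c i) (basis ! \<sigma> i :: ('a, 'f) form)"
    by (rule bchoice[THEN exE])
  then show thesis by (intro that[OF \<sigma>, of c]) simp
qed

section \<open>Independence and spanning\<close>

text \<open>The value is the inner product of two rows, because \<open>lam\<close> reads off the
  coefficients of the vector.\<close>

lemma psi_dual:
  assumes "m < 3" "m' < 3"
  shows "psi m (\<Sum>i\<le>3. of_int (row m' i) *\<^sub>R v i) = (if m = m' then 4 else (0 :: 'f::real_normed_field))"
proof -
  have "(\<Sum>i\<le>3. real_of_int (row m' i)) = 0"
    using row_sum[OF assms(2)] by (simp flip: of_int_sum)
  then have "psi m (\<Sum>i\<le>3. of_int (row m' i) *\<^sub>R v i) = (of_int (\<Sum>i\<le>3. row m i * row m' i) :: 'f)"
    unfolding psi_def of_int_sum by (intro sum.cong) (auto simp: lam_combination(2))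
  then show ?thesis
    unfolding row_orthogonal[OF assms] by simp
qed

lemma basis_independent:
  "distinct (basis :: ('a, 'f::real_normed_field) form list)"
  "forms.independent (set (basis :: ('a, 'f) form list))"
proof -
  define t where "t m = (\<Sum>i\<le>3. of_int (row m i) *\<^sub>R v i)" for m
  \<comment> \<open>The index pairs follow the order of \<open>basis\<close>, so the matching pair
    gives 4 * 4 = 16, and for any other pair both products in the determinant vanish.\<close>
  define us where "us i = [[t 2, t 1], [t 2, t 0], [t 1, t 0]] ! i" for i
  have t: "t m \<in> tangent_space T" if "m < 3" for m
    unfolding t_def using row_sum[OF that] by (intro lam_combination(1)) (simp flip: of_int_sum)
  have psi_t: "psi m (t m') = (if m = m' then 4 else 0 :: 'f)" if "m < 3" "m' < 3" for m m'
    unfolding t_def using that by (rule psi_dual)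
  have eval: "(basis ! j) (v 0) (us i) = (if i = j then 16 else 0 :: 'f)"
    if "i < length (basis :: ('a, 'f) form list)" "j < length (basis :: ('a, 'f) form list)" for i j
  proof -
    have "wedge2 T (psi a) (psi b) (v 0) [t c, t d] =
        psi a (t c) * psi b (t d) - psi a (t d) * (psi b (t c) :: 'f)" if "c < 3" "d < 3" for a b c d
      using that by (simp add: wedge2_def form_on_def t vertex_in_T)
    moreover have "i = 0 \<or> i = 1 \<or> i = 2" "j = 0 \<or> j = 1 \<or> j = 2"
      using that by (auto simp: basis_def)
    ultimately show ?thesis
      by (elim disjE) (simp_all add: basis_nth[unfolded One_nat_def] us_def psi_t)
  qed
  have nonzero: "(16 :: 'f) \<noteq> 0" by simp
  show "distinct (basis :: ('a, 'f) form list)"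
    by (rule independent_forms_if_biorthogonal(1)[OF nonzero eval])
  show "forms.independent (set (basis :: ('a, 'f) form list))"
    by (rule independent_forms_if_biorthogonal(2)[OF nonzero eval])
qed

text \<open>Together with the all-ones vector the rows form an orthogonal matrix up to the factor 2.
  The all-ones component is the sum of the \<open>lam i u\<close>, which is 0 on the tangent
  space.\<close>

lemma lam_eq_psi:
  assumes "i \<le> 3" "u \<in> tangent_space T"
  shows "of_real (lam i u) = (\<Sum>m<3. (of_int (row m i) / 4) * (psi m u :: 'f::real_normed_field))"
proof -
  have "(\<Sum>i\<le>3. of_real (lam i u)) = (0 :: 'f)"
    unfolding of_real_sum[symmetric] sum_lam[OF assms(2)] by (rule of_real_0)
  then have "of_real (lam 0 u) + (of_real (lam 1 u) + (of_real (lam 2 u) + of_real (lam 3 u))) = (0 :: 'f)"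
    by (simp add: atMost_3)
  moreover have "(\<Sum>m<3. of_int (row m i) * psi m u) = 4 * (of_real (lam i u) :: 'f) -
      (of_real (lam 0 u) + (of_real (lam 1 u) + (of_real (lam 2 u) + of_real (lam 3 u))))"
  proof -
    have "{..<3::nat} = {0, 1, 2}" by auto
    then show ?thesis
      using assms(1) unfolding le_3_cases
      by (elim disjE) (simp_all add: psi_expand[unfolded One_nat_def] row_def)
  qed
  ultimately show ?thesis
    by (simp flip: sum_divide_distrib)
qed

lemma constant_forms_eq:
  "constant_forms 3 v 2 =
     forms.span {wedge2 T (\<lambda>u. of_real (lam i u)) (\<lambda>u. of_real (lam j u) :: 'f::real_normed_field) | i j.
       i \<le> 3 \<and> j \<le> 3}"
proof -
  have "{wedge T (map (dlam 3 v) is) | is. length is = 2 \<and> set is \<subseteq> {..3}} =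
      {wedge T [dlam 3 v i, dlam 3 v j] :: ('a, 'f) form | i j. i \<le> 3 \<and> j \<le> 3}" (is "?A = ?B")
  proof
    show "?A \<subseteq> ?B" by (force simp: numeral_2_eq_2 length_Suc_conv)
    show "?B \<subseteq> ?A"
    proof
      fix \<omega> assume "\<omega> \<in> ?B"
      then obtain i j where "\<omega> = wedge T (map (dlam 3 v) [i, j])" "i \<le> 3" "j \<le> 3" by auto
      then show "\<omega> \<in> ?A" by (intro CollectI exI[of _ "[i, j]"]) auto
    qed
  qed
  then show ?thesis unfolding constant_forms_def by (simp add: dlam_eq wedge_covector)
qed

text \<open>Both inclusions expand a product bilinearly: first \<open>psi\<close> through
  \<open>lam\<close>, then \<open>lam\<close> through \<open>psi\<close>.\<close>

lemma span_basis: "forms.span (set basis) = (constant_forms 3 v 2 :: ('a, 'f::real_normed_field) form set)"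
proof
  let ?l = "\<lambda>i u. of_real (lam i u) :: 'f"
  have "wedge2 T (psi a) (psi b) \<in> (constant_forms 3 v 2 :: ('a, 'f) form set)" for a b
    unfolding psi_def constant_forms_eq
    by (intro wedge2_sum_in_span forms.span_base) auto
  then have "set basis \<subseteq> (constant_forms 3 v 2 :: ('a, 'f) form set)"
    by (auto simp: basis_def)
  then show "forms.span (set basis) \<subseteq> (constant_forms 3 v 2 :: ('a, 'f) form set)"
    unfolding constant_forms_eq by (intro forms.span_minimal forms.subspace_span)
  have psi: "wedge2 T (psi a) (psi b) \<in> forms.span (set basis :: ('a, 'f) form set)"
    if "a < 3" "b < 3" for a b
  proof (cases "a = b")
    case True
    show ?thesis unfolding True wedge2_self by (rule forms.span_zero)
  next
    case False
    \<comment> \<open>The remaining index, since 0 + 1 + 2 = 3.\<close>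
    define c where "c = 3 - a - b"
    have c: "c < 3" "a \<noteq> c" "b \<noteq> c" unfolding c_def using that False by presburger+
    obtain s where "wedge2 T (psi a) (psi b) = scale_form s (basis ! c :: ('a, 'f) form)"
      using wedge2_psi[OF \<open>a < 3\<close> \<open>b < 3\<close> c(1) False c(2,3)] by blast
    moreover have "basis ! c \<in> set (basis :: ('a, 'f) form list)"
      using c by (intro nth_mem) (simp add: basis_def)
    ultimately show ?thesis by (simp add: forms.span_base forms.span_scale)
  qed
  have "wedge2 T (?l i) (?l j) \<in> forms.span (set basis)" if "i \<le> 3" "j \<le> 3" for i j
  proof -
    have "wedge2 T (?l i) (?l j) = wedge2 T (\<lambda>u. \<Sum>m<3. (of_int (row m i) / 4) * psi m u)
        (\<lambda>u. \<Sum>m<3. (of_int (row m j) / 4) * psi m u)"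
      using that lam_eq_psi by (intro wedge2_cong) auto
    also have "\<dots> \<in> forms.span (set basis)"
      by (intro wedge2_sum_in_span psi) auto
    finally show ?thesis .
  qed
  then show "(constant_forms 3 v 2 :: ('a, 'f) form set) \<subseteq> forms.span (set basis)"
    unfolding constant_forms_eq by (intro forms.span_minimal forms.subspace_span) auto
qed

text \<open>The scalar field is kept generic, so that the real and the complex claim are two
  instances.\<close>

lemma invariant_basis_basis: "invariant_basis 3 v 2 (basis :: ('a, 'f::real_normed_field) form list)"
proof -
  have len: "length (basis :: ('a, 'f) form list) = 3" by (simp add: basis_def)
  have "invariant_forms 3 v 2 (basis :: ('a, 'f) form list)"
    unfolding invariant_forms_def len
  proof (intro conjI allI impI)
    fix \<pi> :: "nat \<Rightarrow> nat" assume "\<pi> permutes {..3}"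
    from pullback_basis[OF this]
    show "\<exists>\<tau> c. \<tau> permutes {..<3} \<and> (\<forall>i<3. norm (c i) = 1 \<and>
        pullback T 2 (simplex_map 3 v \<pi>) (basis ! i) =
          scale_form (c i) (basis ! \<tau> i :: ('a, 'f) form))"
      by blast
  qed (rule basis_independent(1))
  then show ?thesis
    unfolding invariant_basis_def using basis_independent(2) span_basis by blast
qed

end

theorem lemma5p3:
  fixes v :: "nat \<Rightarrow> 'a::euclidean_space"
  assumes "inj_on v {..3}" and "\<not> affine_dependent (v ` {..3})"
  shows "invariant_basis 3 v 2
           [wedge (simplex_hull 3 v) [psi_w v, psi_p v],
            wedge (simplex_hull 3 v) [psi_w v, psi_k v],
            wedge (simplex_hull 3 v) [psi_p v, psi_k v] :: ('a, real) form] \<and>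
         invariant_basis 3 v 2
           [wedge (simplex_hull 3 v) [psi_w v, psi_p v],
            wedge (simplex_hull 3 v) [psi_w v, psi_k v],
            wedge (simplex_hull 3 v) [psi_p v, psi_k v] :: ('a, complex) form]"
proof -
  interpret tetrahedron v unfolding tetrahedron_def simplex_def using assms by blast
  show ?thesis
    using invariant_basis_basis[where 'f = real] invariant_basis_basis[where 'f = complex]
    by (simp add: basis_def psi_eq wedge_covector)
qed

end
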